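(* For every integer $n\geq 3$, $ar(K^{(3)}_{n,n,n},\mathcal{M})=n+1$ and $ar(K^{(3)}_{n,n,n},\mathcal{T})=ar(K^{(3)}_{n,n,n},\mathcal{L})=n+2$.
   Context: $K^{(3)}_{n,n,n}$ is the complete 3-partite 3-graph with three parts of size $n$. For a 3-partite 3-graph $G$, $ar(K^{(3)}_{n,n,n},G)$ is the minimum $k$ such that every edge-coloring of $K^{(3)}_{n,n,n}$ with at least $k$ colors contains a rainbow copy of $G$ (edges of pairwise distinct colors). $\mathcal{T}$ has edges $\{v_1v_2v_3,v_2v_3v_4,v_3v_4v_5\}$, $\mathcal{M}$ has edges $\{v_1v_2v_3,v_2v_3v_4,v_4v_5v_6\}$, $\mathcal{L}$ has edges $\{v_1v_2v_3,v_3v_4v_5,v_5v_6v_7\}$. *)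

theory Defs
  imports Main
begin

type_synonym 'a hypergraph = "'a set \<times> 'a set set"

abbreviation verts :: "'a hypergraph \<Rightarrow> 'a set" where
  "verts \<equiv> fst"

abbreviation edges :: "'a hypergraph \<Rightarrow> 'a set set" where
  "edges \<equiv> snd"

definition complete_3partite :: "nat \<Rightarrow> (nat \<times> nat) hypergraph" where
  "complete_3partite n =
     ({0..<3} \<times> {0..<n},
      {{(0, a), (1, b), (2, c)} | a b c. a < n \<and> b < n \<and> c < n})"

definition is_embedding :: "'b hypergraph \<Rightarrow> 'a hypergraph \<Rightarrow> ('b \<Rightarrow> 'a) \<Rightarrow> bool" where
  "is_embedding G H f \<longleftrightarrow>
     inj_on f (verts G) \<and> f ` verts G \<subseteq> verts H \<and> (\<forall>e\<in>edges G. f ` e \<in> edges H)"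

definition has_rainbow_copy :: "'a hypergraph \<Rightarrow> ('a set \<Rightarrow> 'c) \<Rightarrow> 'b hypergraph \<Rightarrow> bool" where
  "has_rainbow_copy H col G \<longleftrightarrow>
     (\<exists>f. is_embedding G H f \<and> inj_on col ((\<lambda>e. f ` e) ` edges G))"

text \<open>For a finite host \<^term>\<open>H\<close>, natural-number colors are no restriction, and the minimum is
  attained because the condition is vacuous once \<^term>\<open>k\<close> exceeds the number of edges.\<close>

definition anti_ramsey :: "'a hypergraph \<Rightarrow> 'b hypergraph \<Rightarrow> nat" where
  "anti_ramsey H G =
     (LEAST k. \<forall>col :: 'a set \<Rightarrow> nat. k \<le> card (col ` edges H) \<longrightarrow> has_rainbow_copy H col G)"

definition path_T :: "nat hypergraph" where
  "path_T = ({1..5}, {{1, 2, 3}, {2, 3, 4}, {3, 4, 5}})"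

definition path_M :: "nat hypergraph" where
  "path_M = ({1..6}, {{1, 2, 3}, {2, 3, 4}, {4, 5, 6}})"

definition path_L :: "nat hypergraph" where
  "path_L = ({1..7}, {{1, 2, 3}, {3, 4, 5}, {5, 6, 7}})"

end

theory Submission
  imports Defs
begin

text \<open>
  Edges of the host are points of the cube \<open>{..<n}\<^sup>3\<close>, and two edges meet in as many vertices as the
  points have common coordinates.

  \<^emph>\<open>Loose paths.\<close> If \<open>p\<close> and \<open>q\<close> have no common coordinate and different colours, then every point
  with a third colour lies on an axis-parallel line through \<open>p\<close> or \<open>q\<close>. If there are at least four
  colours, this forces all third colours onto a single line through \<open>p\<close> (or \<open>q\<close>), where there is
  room for only \<open>n - 1\<close> of them.

  \<^emph>\<open>Tight and mixed paths.\<close> An axis-parallel line with three colours forces the colouring to depend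
  on one coordinate only. If there is no such line, then without a rainbow tight path every plane
  has at most two colours, and without a rainbow mixed path the whole cube has at most two colours.

  Extremal colourings give distinct colours to the points of a diagonal (\<open>\<T>\<close>) or of a line
  (\<open>\<L>\<close>) and one further colour to the rest, or colour a point by its first coordinate (\<open>\<M>\<close>).
\<close>

section \<open>Colourings of the cube without rainbow paths, and coordinate symmetries\<close>

definition cube :: "nat \<Rightarrow> (nat \<times> nat \<times> nat) set" where
  "cube n = {..<n} \<times> {..<n} \<times> {..<n}"

definition non_rainbow :: "nat \<Rightarrow> nat \<Rightarrow> nat \<Rightarrow> bool" where
  "non_rainbow x y z \<longleftrightarrow> x = y \<or> y = z \<or> x = z"

text \<open>In a tight path \<open>v1\<close> lies in the part of \<open>v4\<close> and
  \<open>v5\<close> in that of \<open>v2\<close>, so the outer edges change the middle edge in two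
  different coordinates. Equalities such as \<open>a = a'\<close> are harmless: two of the three
  colours then agree.\<close>

definition T_free :: "nat \<Rightarrow> (nat \<times> nat \<times> nat \<Rightarrow> nat) \<Rightarrow> bool" where
  "T_free n h \<longleftrightarrow> (\<forall>a<n. \<forall>b<n. \<forall>c<n. \<forall>a'<n. \<forall>b'<n. \<forall>c'<n.
     non_rainbow (h (a', b, c)) (h (a, b, c)) (h (a, b', c)) \<and>
     non_rainbow (h (a', b, c)) (h (a, b, c)) (h (a, b, c')) \<and>
     non_rainbow (h (a, b', c)) (h (a, b, c)) (h (a, b, c')))"

text \<open>The coordinate treated separately is that of \<open>v4\<close>: the first edge of the
  path changes it, the last keeps it and changes the other two.\<close>

definition M_free :: "nat \<Rightarrow> (nat \<times> nat \<times> nat \<Rightarrow> nat) \<Rightarrow> bool" where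
  "M_free n h \<longleftrightarrow> (\<forall>a<n. \<forall>b<n. \<forall>c<n. \<forall>a'<n. \<forall>b'<n. \<forall>c'<n.
     (b \<noteq> b' \<and> c \<noteq> c' \<longrightarrow> non_rainbow (h (a', b, c)) (h (a, b, c)) (h (a, b', c'))) \<and>
     (a \<noteq> a' \<and> c \<noteq> c' \<longrightarrow> non_rainbow (h (a, b', c)) (h (a, b, c)) (h (a', b, c'))) \<and>
     (a \<noteq> a' \<and> b \<noteq> b' \<longrightarrow> non_rainbow (h (a, b, c')) (h (a, b, c)) (h (a', b', c))))"

text \<open>The end edges are disjoint; the middle one takes a coordinate from each and a new value
  \<open>m\<close> in the remaining part. Three clauses cover all six choices of parts, since
  exchanging the ends yields the others.\<close>

definition L_free :: "nat \<Rightarrow> (nat \<times> nat \<times> nat \<Rightarrow> nat) \<Rightarrow> bool" where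
  "L_free n h \<longleftrightarrow> (\<forall>a<n. \<forall>b<n. \<forall>c<n. \<forall>a'<n. \<forall>b'<n. \<forall>c'<n. \<forall>m<n.
     a \<noteq> a' \<and> b \<noteq> b' \<and> c \<noteq> c' \<longrightarrow>
     (m \<noteq> c \<and> m \<noteq> c' \<longrightarrow> non_rainbow (h (a, b, c)) (h (a, b', m)) (h (a', b', c'))) \<and>
     (m \<noteq> b \<and> m \<noteq> b' \<longrightarrow> non_rainbow (h (a, b, c)) (h (a, m, c')) (h (a', b', c'))) \<and>
     (m \<noteq> a \<and> m \<noteq> a' \<longrightarrow> non_rainbow (h (a, b, c)) (h (m, b, c')) (h (a', b', c'))))"

lemma mem_cube [simp]: "(a, b, c) \<in> cube n \<longleftrightarrow> a < n \<and> b < n \<and> c < n"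
  by (simp add: cube_def)

lemma finite_cube [simp]: "finite (cube n)"
  by (simp add: cube_def)

text \<open>The two transpositions generate all coordinate permutations, so results about the first
  axis carry over to the others.\<close>

definition swap12 :: "nat \<times> nat \<times> nat \<Rightarrow> nat \<times> nat \<times> nat" where
  "swap12 = (\<lambda>(a, b, c). (b, a, c))"

definition swap23 :: "nat \<times> nat \<times> nat \<Rightarrow> nat \<times> nat \<times> nat" where
  "swap23 = (\<lambda>(a, b, c). (a, c, b))"

lemma swap_simps [simp]: "swap12 (a, b, c) = (b, a, c)" "swap23 (a, b, c) = (a, c, b)"
  by (simp_all add: swap12_def swap23_def)

lemma swap_image_cube: "swap12 ` cube n = cube n" "swap23 ` cube n = cube n"
  by (force simp: cube_def swap12_def swap23_def image_iff)+

lemma colours_swap: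
  "(h \<circ> swap12) ` cube n = h ` cube n" "(h \<circ> swap23) ` cube n = h ` cube n"
  by (simp_all only: image_comp [symmetric] swap_image_cube)

lemma non_rainbow_rev: "non_rainbow x y z \<Longrightarrow> non_rainbow z y x"
  by (auto simp: non_rainbow_def)

lemma T_free_rules:
  assumes "T_free n h" "a < n" "b < n" "c < n" "a' < n" "b' < n" "c' < n"
  shows "non_rainbow (h (a', b, c)) (h (a, b, c)) (h (a, b', c))"
    and "non_rainbow (h (a', b, c)) (h (a, b, c)) (h (a, b, c'))"
    and "non_rainbow (h (a, b', c)) (h (a, b, c)) (h (a, b, c'))"
  using assms unfolding T_free_def by simp_all

lemma L_free_rules:
  assumes "L_free n h" "a < n" "b < n" "c < n" "a' < n" "b' < n" "c' < n" "m < n"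
    "a \<noteq> a'" "b \<noteq> b'" "c \<noteq> c'"
  shows "m \<noteq> c \<Longrightarrow> m \<noteq> c' \<Longrightarrow> non_rainbow (h (a, b, c)) (h (a, b', m)) (h (a', b', c'))"
    and "m \<noteq> b \<Longrightarrow> m \<noteq> b' \<Longrightarrow> non_rainbow (h (a, b, c)) (h (a, m, c')) (h (a', b', c'))"
    and "m \<noteq> a \<Longrightarrow> m \<noteq> a' \<Longrightarrow> non_rainbow (h (a, b, c)) (h (m, b, c')) (h (a', b', c'))"
  using assms unfolding L_free_def by simp_all

lemma T_free_swap:
  assumes "T_free n h"
  shows "T_free n (h \<circ> swap12)" "T_free n (h \<circ> swap23)"
  unfolding T_free_def comp_def swap_simps
  \<comment> \<open>A permutation can turn a clause into its reversal, whence
    \<open>non_rainbow_rev\<close>.\<close>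
  by (intro allI impI conjI;
      (rule T_free_rules [OF assms] | rule non_rainbow_rev, rule T_free_rules [OF assms]); simp)+

lemma M_free_swap:
  assumes "M_free n h"
  shows "M_free n (h \<circ> swap12)" "M_free n (h \<circ> swap23)"
  using assms unfolding M_free_def by simp_all

lemma L_free_swap:
  assumes "L_free n h"
  shows "L_free n (h \<circ> swap12)" "L_free n (h \<circ> swap23)"
  unfolding L_free_def comp_def swap_simps
  by (intro allI impI conjI;
      (rule L_free_rules [OF assms] | rule non_rainbow_rev, rule L_free_rules [OF assms]); simp)+

lemma exists_fresh:
  assumes "(n::nat) \<ge> 3"
  obtains m where "m < n" "m \<noteq> x" "m \<noteq> y"
proof -
  have "\<not> {..<n} \<subseteq> {x, y}"
    using card_mono [of "{x, y}" "{..<n}"] assms card_insert_le_m1 [of 2 "{y}" x] by auto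
  then show ?thesis using that by auto
qed

lemma ex_point_outside:
  assumes "card B < card (h ` A)" "finite B"
  obtains x where "x \<in> A" "h x \<notin> B"
  using assms card_mono [of B "h ` A"] by (metis image_subsetI leD)

lemma card_two_le: "card {x, y} \<le> 2" and card_three_le: "card {x, y, z} \<le> 3"
  by (simp_all add: card_insert_if)

lemma card_le_two: "A \<subseteq> {x, y} \<Longrightarrow> card A \<le> 2"
  using card_mono [of "{x, y}" A] card_two_le [of x y] by simp

lemma card_image_first_coordinate:
  assumes "\<And>i j k. i < n \<Longrightarrow> j < n \<Longrightarrow> k < n \<Longrightarrow> h (i, j, k) = f i"
  shows "card (h ` cube n) \<le> n"
proof -
  have "h ` cube n \<subseteq> f ` {..<n}" using assms by (auto simp: cube_def)
  then have "card (h ` cube n) \<le> card {..<n}" by (intro surj_card_le) auto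
  then show ?thesis by simp
qed

section \<open>Loose paths\<close>

fun disjoint_pts :: "nat \<times> nat \<times> nat \<Rightarrow> nat \<times> nat \<times> nat \<Rightarrow> bool" where
  "disjoint_pts (a, b, c) (a', b', c') \<longleftrightarrow> a \<noteq> a' \<and> b \<noteq> b' \<and> c \<noteq> c'"

text \<open>Reflexive: as edges, the points share at least two vertices, possibly all three.\<close>

fun collinear :: "nat \<times> nat \<times> nat \<Rightarrow> nat \<times> nat \<times> nat \<Rightarrow> bool" where
  "collinear (a, b, c) (a', b', c') \<longleftrightarrow>
     a = a' \<and> b = b' \<or> a = a' \<and> c = c' \<or> b = b' \<and> c = c'"

lemma exists_disjoint:
  assumes "n \<ge> 3"
  obtains t where "t \<in> cube n" "disjoint_pts t p" "disjoint_pts t q"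
proof -
  obtain a b c where p: "p = (a, b, c)" by (cases p)
  obtain a' b' c' where q: "q = (a', b', c')" by (cases q)
  obtain x where "x < n" "x \<noteq> a" "x \<noteq> a'" using exists_fresh [OF assms] .
  moreover obtain y where "y < n" "y \<noteq> b" "y \<noteq> b'" using exists_fresh [OF assms] .
  moreover obtain z where "z < n" "z \<noteq> c" "z \<noteq> c'" using exists_fresh [OF assms] .
  ultimately show ?thesis using that [of "(x, y, z)"] p q by simp
qed

text \<open>The point \<open>(a, y, z)\<close> shares exactly one coordinate with one of the two disjoint points and
  none with the other. The colours of \<open>(m, b', z)\<close> and \<open>(a', b, z)\<close> are then forced, and these two
  points form a rainbow loose path with \<open>(a, b, c)\<close>.\<close>

lemma L_free_no_single_agreement:
  assumes L: "L_free n h" and n: "n \<ge> 3"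
    and bounds: "a < n" "b < n" "c < n" "a' < n" "b' < n" "c' < n" "y < n" "z < n"
    and ne: "a \<noteq> a'" "b \<noteq> b'" "c \<noteq> c'" "y \<noteq> b" "y \<noteq> b'" "z \<noteq> c" "z \<noteq> c'"
    and col: "h (a, b, c) \<noteq> h (a', b', c')"
      "h (a, y, z) \<noteq> h (a, b, c)" "h (a, y, z) \<noteq> h (a', b', c')"
  shows False
proof -
  obtain m where m: "m < n" "m \<noteq> a" "m \<noteq> a'" using exists_fresh [OF n] .
  have "non_rainbow (h (a, b, c)) (h (a, y, z)) (h (m, b', z))"
    by (rule L_free_rules(2) [OF L]) (use bounds ne m in auto)
  moreover have "non_rainbow (h (a', b', c')) (h (m, b', z)) (h (a, y, z))"
    by (rule L_free_rules(3) [OF L]) (use bounds ne m in auto)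
  ultimately have 1: "h (m, b', z) = h (a, y, z)"
    using col by (auto simp: non_rainbow_def)
  have "non_rainbow (h (a', b', c')) (h (a', b, z)) (h (a, b, c))"
    by (rule L_free_rules(1) [OF L]) (use bounds ne in auto)
  moreover have "non_rainbow (h (a', b', c')) (h (a', b, z)) (h (a, y, z))"
    by (rule L_free_rules(2) [OF L]) (use bounds ne in auto)
  ultimately have 2: "h (a', b, z) = h (a', b', c')"
    using col by (auto simp: non_rainbow_def)
  have "non_rainbow (h (a, b, c)) (h (a', b, z)) (h (m, b', z))"
    by (rule L_free_rules(3) [OF L]) (use bounds ne m in auto)
  then show False using 1 2 col by (auto simp: non_rainbow_def)
qed

text \<open>The point \<open>(a, b', z)\<close> shares one vertex with each of the three disjoint
  edges, so it joins any two of them to a loose path. If their colours were distinct, no colour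
  would be left for it.\<close>

lemma L_free_no_rainbow_matching:
  assumes L: "L_free n h"
    and bounds: "a < n" "b < n" "c < n" "a' < n" "b' < n" "c' < n" "x < n" "y < n" "z < n"
    and ne: "a \<noteq> a'" "b \<noteq> b'" "c \<noteq> c'" "x \<noteq> a" "x \<noteq> a'" "y \<noteq> b" "y \<noteq> b'" "z \<noteq> c" "z \<noteq> c'"
  shows "non_rainbow (h (a, b, c)) (h (a', b', c')) (h (x, y, z))"
proof -
  have "non_rainbow (h (a, b, c)) (h (a, b', z)) (h (a', b', c'))"
    by (rule L_free_rules(1) [OF L]) (use bounds ne in auto)
  moreover have "non_rainbow (h (a', b', c')) (h (a, b', z)) (h (x, y, z))"
    by (rule L_free_rules(3) [OF L]) (use bounds ne in auto)
  moreover have "non_rainbow (h (a, b, c)) (h (a, b', z)) (h (x, y, z))"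
    by (rule L_free_rules(2) [OF L]) (use bounds ne in auto)
  ultimately show ?thesis unfolding non_rainbow_def by metis
qed

text \<open>Otherwise \<open>r\<close> agrees with \<open>p\<close> in at most one coordinate, and
  likewise with \<open>q\<close>. If it agrees once with each, \<open>p\<close>, \<open>r\<close>,
  \<open>q\<close> is itself a loose path; the other cases are the two preceding lemmas.\<close>

lemma L_free_third_colour:
  assumes L: "L_free n h" and n: "n \<ge> 3"
    and pts: "p \<in> cube n" "q \<in> cube n" "r \<in> cube n" and pq: "disjoint_pts p q"
    and col: "h p \<noteq> h q" "h r \<noteq> h p" "h r \<noteq> h q"
  shows "collinear r p \<or> collinear r q"
proof (rule ccontr)
  assume far: "\<not> (collinear r p \<or> collinear r q)"
  obtain a b c where p: "p = (a, b, c)" by (cases p)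
  obtain a' b' c' where q: "q = (a', b', c')" by (cases q)
  obtain x y z where r: "r = (x, y, z)" by (cases r)
  have bounds: "a < n" "b < n" "c < n" "a' < n" "b' < n" "c' < n" "x < n" "y < n" "z < n"
    using pts by (simp_all add: p q r)
  have ne: "a \<noteq> a'" "b \<noteq> b'" "c \<noteq> c'" using pq by (simp_all add: p q)
  note col' = col [unfolded p q r] and far' = far [unfolded p q r, simplified]
  \<comment> \<open>The threefold composite exchanges the first and third coordinates.\<close>
  note L12 = L_free_swap(1) [OF L] and L13 = L_free_swap(2) [OF L_free_swap(1) [OF L_free_swap(2) [OF L]]]
  note single = L_free_no_single_agreement [OF _ n]
  have "non_rainbow (h (a, b, c)) (h (x, y, z)) (h (a', b', c'))"
    if "x = a \<and> y = b' \<or> x = a' \<and> y = b"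
    using that L_free_rules(1) [OF L, of a b c a' b' c' z] L_free_rules(1) [OF L, of a' b' c' a b c z]
      bounds ne far' by (auto simp: non_rainbow_def)
  moreover have "non_rainbow (h (a, b, c)) (h (x, y, z)) (h (a', b', c'))"
    if "x = a \<and> z = c' \<or> x = a' \<and> z = c"
    using that L_free_rules(2) [OF L, of a b c a' b' c' y] L_free_rules(2) [OF L, of a' b' c' a b c y]
      bounds ne far' by (auto simp: non_rainbow_def)
  moreover have "non_rainbow (h (a, b, c)) (h (x, y, z)) (h (a', b', c'))"
    if "y = b \<and> z = c' \<or> y = b' \<and> z = c"
    using that L_free_rules(3) [OF L, of a b c a' b' c' x] L_free_rules(3) [OF L, of a' b' c' a b c x]
      bounds ne far' by (auto simp: non_rainbow_def)
  moreover have False if "y \<noteq> b" "y \<noteq> b'" "z \<noteq> c" "z \<noteq> c'" "x = a \<or> x = a'"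
    using that single [OF L, of a b c a' b' c' y z] single [OF L, of a' b' c' a b c y z]
      bounds ne col' by auto
  moreover have False if "x \<noteq> a" "x \<noteq> a'" "z \<noteq> c" "z \<noteq> c'" "y = b \<or> y = b'"
    using that single [OF L12, of b a c b' a' c' x z] single [OF L12, of b' a' c' b a c x z]
      bounds ne col' by auto
  moreover have False if "x \<noteq> a" "x \<noteq> a'" "y \<noteq> b" "y \<noteq> b'" "z = c \<or> z = c'"
    using that single [OF L13, of c b a c' b' a' y x] single [OF L13, of c' b' a' c b a y x]
      bounds ne col' by auto
  moreover have False if "x \<noteq> a" "x \<noteq> a'" "y \<noteq> b" "y \<noteq> b'" "z \<noteq> c" "z \<noteq> c'"
    using that L_free_no_rainbow_matching [OF L, of a b c a' b' c' x y z]
      bounds ne col' by (auto simp: non_rainbow_def)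
  ultimately show False using far' ne col' unfolding non_rainbow_def by metis
qed

lemma collinear_commute: "collinear p q \<longleftrightarrow> collinear q p"
  by (cases p; cases q; auto)

lemma disjoint_not_collinear: "disjoint_pts p q \<Longrightarrow> \<not> collinear p q"
  by (cases p; cases q; auto)

lemma disjoint_collinear_not_collinear:
  "disjoint_pts p q \<Longrightarrow> collinear r p \<Longrightarrow> \<not> collinear r q"
  "disjoint_pts q p \<Longrightarrow> collinear r p \<Longrightarrow> \<not> collinear r q"
  by (cases p; cases q; cases r; auto)+

text \<open>A point \<open>t\<close> disjoint from \<open>r\<close> and \<open>s\<close> is
  collinear with neither \<open>p\<close> nor \<open>q\<close>, so it has one of their colours. If
  it is that of \<open>p\<close>, the disjoint pair \<open>t\<close>, \<open>r\<close> rules out the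
  colour of \<open>q\<close>; if it is that of \<open>q\<close>, the pair \<open>t\<close>,
  \<open>s\<close> rules out the colour of \<open>p\<close>.\<close>

lemma L_free_colours_not_split:
  assumes L: "L_free n h" and n: "n \<ge> 3"
    and pts: "p \<in> cube n" "q \<in> cube n" "r \<in> cube n" "s \<in> cube n" and pq: "disjoint_pts p q"
    and col: "h p \<noteq> h q" "h r \<notin> {h p, h q}" "h s \<notin> {h p, h q}" "h r \<noteq> h s"
    and near: "collinear r p" "collinear s q"
  shows False
proof -
  obtain t where t: "t \<in> cube n" "disjoint_pts t r" "disjoint_pts t s"
    using exists_disjoint [OF n] .
  have tp: "\<not> collinear t p" and tq: "\<not> collinear t q"
    using disjoint_collinear_not_collinear(2) near t collinear_commute by blast+
  have rq: "\<not> collinear q r" and sp: "\<not> collinear p s"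
    using disjoint_collinear_not_collinear near pq collinear_commute by blast+
  have ht: "h t = h p \<or> h t = h q"
    using L_free_third_colour [OF L n pts(1,2) t(1) pq col(1)] tp tq by blast
  have "h t \<noteq> h p"
    using L_free_third_colour [OF L n t(1) pts(3,2) t(2)] rq tq col collinear_commute by fastforce
  moreover have "h t \<noteq> h q"
    using L_free_third_colour [OF L n t(1) pts(4,1) t(3)] sp tp col collinear_commute by fastforce
  ultimately show False using ht by blast
qed

lemma L_free_colours_le_if_near:
  assumes L: "L_free n h" and n: "n \<ge> 3"
    and pts: "p \<in> cube n" "q \<in> cube n" and pq: "disjoint_pts p q" and hpq: "h p \<noteq> h q"
    and near: "\<And>r. r \<in> cube n \<Longrightarrow> h r \<notin> {h p, h q} \<Longrightarrow> collinear r p"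
  shows "card (h ` cube n) \<le> n + 1"
proof -
  define W where "W = h ` cube n - {h p, h q}"
  have fin_W: "finite W" by (simp add: W_def)
  \<comment> \<open>A point \<open>t\<close> disjoint from both is not collinear with
    \<open>p\<close>, hence has the colour of \<open>p\<close> or \<open>q\<close>. Then
    \<open>s\<close> has a third colour for the disjoint pair \<open>t\<close>, \<open>r\<close>,
    and it is not collinear with \<open>t\<close>.\<close>
  have pairwise: "collinear r s"
    if rs: "r \<in> cube n" "s \<in> cube n" "h r \<in> W" "h s \<in> W" "h r \<noteq> h s" for r s
  proof (rule ccontr)
    assume nrs: "\<not> collinear r s"
    obtain t where t: "t \<in> cube n" "disjoint_pts t r" "disjoint_pts t s"
      using exists_disjoint [OF n] .
    have "collinear r p" using near rs by (auto simp: W_def)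
    then have "\<not> collinear t p"
      using disjoint_collinear_not_collinear(2) t collinear_commute by blast
    then have "h t = h p \<or> h t = h q" using near t by blast
    then have "collinear s t \<or> collinear s r"
      using L_free_third_colour [OF L n t(1) rs(1,2) t(2)] rs by (auto simp: W_def)
    then show False using t nrs collinear_commute disjoint_not_collinear by blast
  qed
  obtain a b c where p: "p = (a, b, c)" by (cases p)
  have abc: "a < n" "b < n" "c < n" using pts by (simp_all add: p)
  have "card W \<le> n - 1"
  proof (cases "W = {}")
    case False
    then obtain r where r: "r \<in> cube n" "h r \<in> W" by (auto simp: W_def)
    have line: "collinear s p \<and> collinear s r \<and> s \<noteq> p" if "s \<in> cube n" "h s \<in> W" "h s \<noteq> h r" for s
      using pairwise [of s r] near [of s] that r by (auto simp: W_def)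
    have rp: "collinear r p" "r \<noteq> p" using near r by (auto simp: W_def)
    obtain x y z where xyz: "r = (x, y, z)" by (cases r)
    \<comment> \<open>Points on different axes through \<open>p\<close> are not collinear, so all of
      \<open>W\<close> is seen on the line through \<open>p\<close> and \<open>r\<close>. Here
      \<open>f\<close> lists the colours on that line and \<open>k\<close> is the position of
      \<open>p\<close>, leaving \<open>n - 1\<close> places.\<close>
    have "\<exists>f k. k < n \<and> W \<subseteq> f ` ({..<n} - {k})"
    proof -
      consider "x = a" "y = b" "z \<noteq> c" | "x = a" "y \<noteq> b" "z = c" | "x \<noteq> a" "y = b" "z = c"
        using rp by (auto simp: xyz p)
      then show ?thesis
      proof cases
        case 1
        have "W \<subseteq> (\<lambda>i. h (a, b, i)) ` ({..<n} - {c})"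
        proof
          fix w assume w: "w \<in> W"
          then obtain s where s: "s \<in> cube n" "h s = w" by (auto simp: W_def)
          show "w \<in> (\<lambda>i. h (a, b, i)) ` ({..<n} - {c})"
            using line [of s] r s w 1 by (cases s; cases "w = h r") (auto simp: xyz p)
        qed
        then show ?thesis using abc by blast
      next
        case 2
        have "W \<subseteq> (\<lambda>i. h (a, i, c)) ` ({..<n} - {b})"
        proof
          fix w assume w: "w \<in> W"
          then obtain s where s: "s \<in> cube n" "h s = w" by (auto simp: W_def)
          show "w \<in> (\<lambda>i. h (a, i, c)) ` ({..<n} - {b})"
            using line [of s] r s w 2 by (cases s; cases "w = h r") (auto simp: xyz p)
        qed
        then show ?thesis using abc by blast
      next
        case 3
        have "W \<subseteq> (\<lambda>i. h (i, b, c)) ` ({..<n} - {a})"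
        proof
          fix w assume w: "w \<in> W"
          then obtain s where s: "s \<in> cube n" "h s = w" by (auto simp: W_def)
          show "w \<in> (\<lambda>i. h (i, b, c)) ` ({..<n} - {a})"
            using line [of s] r s w 3 by (cases s; cases "w = h r") (auto simp: xyz p)
        qed
        then show ?thesis using abc by blast
      qed
    qed
    then obtain f k where fk: "k < n" "W \<subseteq> f ` ({..<n} - {k})" by blast
    have "card W \<le> card ({..<n} - {k})" using surj_card_le [OF _ fk(2)] by simp
    then show ?thesis using fk(1) by simp
  qed simp
  moreover have "h ` cube n \<subseteq> insert (h p) (insert (h q) W)" by (auto simp: W_def)
  then have "card (h ` cube n) \<le> card (insert (h p) (insert (h q) W))"
    by (intro card_mono) (auto simp: W_def)
  moreover have "card (insert (h p) (insert (h q) W)) \<le> card W + 2"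
    using fin_W by (simp add: card_insert_if)
  ultimately show ?thesis using n by linarith
qed

lemma L_free_colours_le:
  assumes L: "L_free n h" and n: "n \<ge> 3"
  shows "card (h ` cube n) \<le> n + 1"
proof (rule ccontr)
  assume too_many: "\<not> ?thesis"
  then have many: "card (h ` cube n) \<ge> 5" using n by linarith
  obtain u where u: "u \<in> cube n" using n that [of "(0, 0, 0)"] by auto
  obtain v where v: "v \<in> cube n" "h v \<noteq> h u"
    using ex_point_outside [of "{h u}" h "cube n"] many by auto
  \<comment> \<open>Since \<open>u\<close> and \<open>v\<close> have different colours,
    \<open>t\<close> differs in colour from one of them; this gives the pair \<open>p\<close>,
    \<open>q\<close>.\<close>
  obtain t where t: "t \<in> cube n" "disjoint_pts t u" "disjoint_pts t v"
    using exists_disjoint [OF n] .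
  obtain p q where pts: "p \<in> cube n" "q \<in> cube n" and pq: "disjoint_pts p q" and hpq: "h p \<noteq> h q"
    using u v t by metis
  have qp: "disjoint_pts q p" using pq by (cases p; cases q) auto
  have "card {h p, h q} < card (h ` cube n)"
    using many card_two_le [of "h p" "h q"] by linarith
  then obtain r where r: "r \<in> cube n" "h r \<notin> {h p, h q}"
    using ex_point_outside [of "{h p, h q}" h "cube n"] by blast
  have "card {h p, h q, h r} < card (h ` cube n)"
    using many card_three_le [of "h p" "h q" "h r"] by linarith
  then obtain s where s: "s \<in> cube n" "h s \<notin> {h p, h q, h r}"
    using ex_point_outside [of "{h p, h q, h r}" h "cube n"] by blast
  have near: "collinear x p \<or> collinear x q" if "x \<in> cube n" "h x \<notin> {h p, h q}" for x
    using L_free_third_colour [OF L n pts that(1) pq hpq] that(2) by auto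
  have same: "\<not> (collinear x p \<and> collinear y q)"
    if "x \<in> cube n" "h x \<notin> {h p, h q}" "y \<in> cube n" "h y \<notin> {h p, h q}" "h x \<noteq> h y" for x y
    using L_free_colours_not_split [OF L n pts that(1,3) pq hpq that(2,4,5)] by blast
  have "(\<forall>x\<in>cube n. h x \<notin> {h p, h q} \<longrightarrow> collinear x p) \<or>
        (\<forall>x\<in>cube n. h x \<notin> {h q, h p} \<longrightarrow> collinear x q)"
  proof (rule ccontr)
    assume "\<not> ?thesis"
    then obtain x y where x: "x \<in> cube n" "h x \<notin> {h p, h q}" "\<not> collinear x p"
      and y: "y \<in> cube n" "h y \<notin> {h p, h q}" "\<not> collinear y q"
      by blast
    have near_xy: "collinear x q" "collinear y p" using near x y by blast+
    \<comment> \<open>One of \<open>r\<close>, \<open>s\<close> differs in colour from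
      \<open>x\<close>. Whether \<open>w\<close> is collinear with \<open>p\<close> or with
      \<open>q\<close>, it forms a forbidden split with \<open>x\<close> or \<open>y\<close>, whose
      colours agree.\<close>
    obtain w where w: "w \<in> cube n" "h w \<notin> {h p, h q}" "h w \<noteq> h x"
      using r s that by (cases "h r = h x") auto
    have "h x = h y" using same [OF y(1,2) x(1,2)] near_xy by metis
    then show False
      using near [OF w(1,2)] same [OF w(1,2) x(1,2)] same [OF y(1,2) w(1,2)] near_xy w(3) by auto
  qed
  then show False
    using L_free_colours_le_if_near [OF L n pts pq hpq]
      L_free_colours_le_if_near [OF L n pts(2,1) qp] hpq too_many by metis
qed

section \<open>Tight paths\<close>

text \<open>If the colour changed on leaving the line at \<open>i\<close>, every point of the line
  would have one of the two colours involved, contrary to there being three.\<close>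

lemma T_free_rich_line_aux:
  assumes T: "T_free n h" and bounds: "b < n" "c < n"
    and rich: "x < n" "y < n" "z < n" "h (x, b, c) \<noteq> h (y, b, c)" "h (y, b, c) \<noteq> h (z, b, c)"
      "h (x, b, c) \<noteq> h (z, b, c)" and i: "i < n" and j: "j < n"
  shows "h (i, j, c) = h (i, b, c)" "h (i, b, j) = h (i, b, c)"
proof -
  have 1: "non_rainbow (h (k, b, c)) (h (i, b, c)) (h (i, j, c))" if "k < n" for k
    by (rule T_free_rules(1) [OF T]) (use that i j bounds in auto)
  show "h (i, j, c) = h (i, b, c)"
    using 1 [OF rich(1)] 1 [OF rich(2)] 1 [OF rich(3)] rich(4-6) unfolding non_rainbow_def by metis
  have 2: "non_rainbow (h (k, b, c)) (h (i, b, c)) (h (i, b, j))" if "k < n" for k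
    by (rule T_free_rules(2) [OF T]) (use that i j bounds in auto)
  show "h (i, b, j) = h (i, b, c)"
    using 2 [OF rich(1)] 2 [OF rich(2)] 2 [OF rich(3)] rich(4-6) unfolding non_rainbow_def by metis
qed

text \<open>Each parallel line in the plane \<open>z = c\<close> repeats the colours, so it is again
  rich and passes them on in the third direction.\<close>

lemma T_free_rich_line:
  assumes T: "T_free n h" and bounds: "b < n" "c < n" "x < n" "y < n" "z < n"
    and rich: "\<not> non_rainbow (h (x, b, c)) (h (y, b, c)) (h (z, b, c))"
  shows "card (h ` cube n) \<le> n"
proof (rule card_image_first_coordinate [where f = "\<lambda>i. h (i, b, c)"])
  have rich': "h (x, b, c) \<noteq> h (y, b, c)" "h (y, b, c) \<noteq> h (z, b, c)" "h (x, b, c) \<noteq> h (z, b, c)"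
    using rich by (auto simp: non_rainbow_def)
  fix i j k assume ijk: "i < n" "j < n" "k < n"
  have line: "h (l, j, c) = h (l, b, c)" if "l < n" for l
    by (rule T_free_rich_line_aux(1) [OF T bounds(1,2) bounds(3-5) rich' that ijk(2)])
  have "h (i, j, k) = h (i, j, c)"
    by (rule T_free_rich_line_aux(2) [OF T ijk(2) bounds(2) bounds(3-5) _ _ _ ijk(1,3)])
      (use line bounds rich' in simp_all)
  then show "h (i, j, k) = h (i, b, c)" using line ijk(1) by simp
qed

text \<open>Suppose \<open>f x y\<close> is a third colour. The corners at \<open>(a, b)\<close> and
  \<open>(a', b)\<close> keep it away from \<open>f a y\<close> and \<open>f a' y\<close>; the
  corners at \<open>(x, y)\<close>, \<open>(a, y)\<close> and \<open>(a', y)\<close> then give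
  \<open>f a b = f x b = f a' b\<close>.\<close>

lemma two_coloured_grid_aux:
  fixes f :: "nat \<Rightarrow> nat \<Rightarrow> nat"
  assumes row: "\<And>i j k l. i < n \<Longrightarrow> j < n \<Longrightarrow> k < n \<Longrightarrow> l < n \<Longrightarrow>
      non_rainbow (f i j) (f k j) (f l j)"
    and corner: "\<And>i j k l. i < n \<Longrightarrow> j < n \<Longrightarrow> k < n \<Longrightarrow> l < n \<Longrightarrow>
      non_rainbow (f k j) (f i j) (f i l)"
    and bounds: "a < n" "b < n" "a' < n" "x < n" "y < n"
    and ne: "f a b \<noteq> f a' b"
  shows "f x y \<in> {f a b, f a' b}"
proof (rule ccontr)
  assume third: "f x y \<notin> {f a b, f a' b}"
  have 1: "non_rainbow (f a b) (f a' b) (f x b)" using row bounds by blast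
  have 2: "non_rainbow (f a' b) (f a b) (f a y)" using corner bounds by blast
  have 3: "non_rainbow (f a b) (f a' b) (f a' y)" using corner bounds by blast
  have 4: "non_rainbow (f a y) (f x y) (f x b)" using corner bounds by blast
  have 5: "non_rainbow (f a' y) (f x y) (f x b)" using corner bounds by blast
  have 6: "non_rainbow (f x y) (f a y) (f a b)" using corner bounds by blast
  have 7: "non_rainbow (f x y) (f a' y) (f a' b)" using corner bounds by blast
  have "f x b \<noteq> f x y" "f a y \<noteq> f x y" "f a' y \<noteq> f x y"
    using 1 2 3 third ne by (auto simp: non_rainbow_def)
  then have "f a y = f x b" "f a' y = f x b" "f a y = f a b" "f a' y = f a' b"
    using 4 5 6 7 third by (auto simp: non_rainbow_def)
  then show False using ne by simp
qed

text \<open>The two colours are named at points with a common coordinate, so that both occur on one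
  plane perpendicular to the grid when grids become planes of the cube.\<close>

lemma two_coloured_grid:
  fixes f :: "nat \<Rightarrow> nat \<Rightarrow> nat"
  assumes row: "\<And>i j k l. i < n \<Longrightarrow> j < n \<Longrightarrow> k < n \<Longrightarrow> l < n \<Longrightarrow>
      non_rainbow (f i j) (f k j) (f l j)"
    and column: "\<And>i j k l. i < n \<Longrightarrow> j < n \<Longrightarrow> k < n \<Longrightarrow> l < n \<Longrightarrow>
      non_rainbow (f i j) (f i k) (f i l)"
    and corner: "\<And>i j k l. i < n \<Longrightarrow> j < n \<Longrightarrow> k < n \<Longrightarrow> l < n \<Longrightarrow>
      non_rainbow (f k j) (f i j) (f i l)"
    and n: "0 < n"
  obtains a b a' where "a < n" "b < n" "a' < n"
      "\<And>x y. x < n \<Longrightarrow> y < n \<Longrightarrow> f x y \<in> {f a b, f a' b}"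
    | a b b' where "a < n" "b < n" "b' < n"
      "\<And>x y. x < n \<Longrightarrow> y < n \<Longrightarrow> f x y \<in> {f a b, f a b'}"
proof -
  show ?thesis
  proof (cases "\<exists>a<n. \<exists>b<n. \<exists>a'<n. f a b \<noteq> f a' b")
    case True
    then obtain a b a' where ab: "a < n" "b < n" "a' < n" "f a b \<noteq> f a' b" by blast
    show ?thesis
    proof (rule that(1) [OF ab(1-3)])
      fix x y assume xy: "x < n" "y < n"
      show "f x y \<in> {f a b, f a' b}"
        by (rule two_coloured_grid_aux [of n f]) (rule row corner ab xy; assumption)+
    qed
  next
    case no_row: False
    show ?thesis
    proof (cases "\<exists>a<n. \<exists>b<n. \<exists>b'<n. f a b \<noteq> f a b'")
      case True
      then obtain a b b' where ab: "a < n" "b < n" "b' < n" "f a b \<noteq> f a b'" by blast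
      show ?thesis
      proof (rule that(2) [OF ab(1-3)])
        fix x y assume xy: "x < n" "y < n"
        show "f x y \<in> {f a b, f a b'}"
          \<comment> \<open>Transposing the grid also reverses the corners.\<close>
          by (rule two_coloured_grid_aux [of n "\<lambda>j i. f i j"])
            (rule column non_rainbow_rev [OF corner] ab xy; assumption)+
      qed
    next
      case False
      have "f x y = f 0 0" if "x < n" "y < n" for x y
      proof -
        have "f x y = f 0 y" using no_row that n by blast
        also have "\<dots> = f 0 0" using False that n by blast
        finally show ?thesis .
      qed
      \<comment> \<open>A constant grid is reported as a degenerate instance of the first
        alternative.\<close>
      then show ?thesis using that(1) [of 0 0 0] n by blast
    qed
  qed
qed

text \<open>The plane \<open>x = 0\<close> meets every plane \<open>z = k\<close>, so each of these contributes at most one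
  colour that does not occur on \<open>x = 0\<close>, and both colours of \<open>x = 0\<close> already occur on \<open>z = c\<close>.\<close>

lemma card_colours_by_planes:
  assumes n: "c < n"
    and planes: "\<And>k. k < n \<Longrightarrow> card ((\<lambda>(i, j). h (i, j, k)) ` ({..<n} \<times> {..<n})) \<le> 2"
    and base: "\<And>j k. j < n \<Longrightarrow> k < n \<Longrightarrow> h (0, j, k) \<in> {h (0, b, c), h (0, b', c)}"
    and b: "b < n" "b' < n"
  shows "card (h ` cube n) \<le> n + 1"
proof -
  define A where "A k = (\<lambda>(i, j). h (i, j, k)) ` ({..<n} \<times> {..<n})" for k
  define B where "B = {h (0, b, c), h (0, b', c)}"
  have fin: "finite (A k)" for k by (simp add: A_def)
  have B: "B \<subseteq> A c" using b n unfolding A_def B_def by force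
  have diff: "card (A k - B) \<le> 1" if "k < n" for k
  proof -
    have "h (0, 0, k) \<in> A k" using that n unfolding A_def by force
    moreover have "h (0, 0, k) \<in> B" using base that n unfolding B_def by auto
    ultimately have "A k - B \<subset> A k" by blast
    then have "card (A k - B) < card (A k)" by (intro psubset_card_mono fin)
    then show ?thesis using planes [OF that] by (simp add: A_def)
  qed
  have "h ` cube n \<subseteq> A c \<union> (\<Union>k\<in>{..<n} - {c}. A k - B)"
  proof (rule image_subsetI)
    fix p assume p: "p \<in> cube n"
    obtain i j k where ijk: "p = (i, j, k)" by (cases p)
    have "h p \<in> A k" using p unfolding A_def ijk by force
    then show "h p \<in> A c \<union> (\<Union>k\<in>{..<n} - {c}. A k - B)"
      using B p by (auto simp: ijk)
  qed
  then have "card (h ` cube n) \<le> card (A c \<union> (\<Union>k\<in>{..<n} - {c}. A k - B))"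
    by (intro card_mono) (auto simp: fin)
  also have "\<dots> \<le> card (A c) + card (\<Union>k\<in>{..<n} - {c}. A k - B)" by (rule card_Un_le)
  also have "card (\<Union>k\<in>{..<n} - {c}. A k - B) \<le> (\<Sum>k\<in>{..<n} - {c}. card (A k - B))"
    by (rule card_UN_le) simp
  also have "\<dots> \<le> (\<Sum>k\<in>{..<n} - {c}. 1)" by (intro sum_mono diff) auto
  also have "\<dots> = n - 1" using n by simp
  finally show ?thesis using planes [OF n] n by (simp add: A_def)
qed

lemma T_free_colours_le_if_lines_two_coloured:
  assumes T: "T_free n h" and n: "0 < n"
    and lines: "\<And>a b c x y. a < n \<Longrightarrow> b < n \<Longrightarrow> c < n \<Longrightarrow> x < n \<Longrightarrow> y < n \<Longrightarrow>
        non_rainbow (h (a, b, c)) (h (x, b, c)) (h (y, b, c))"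
      "\<And>a b c x y. a < n \<Longrightarrow> b < n \<Longrightarrow> c < n \<Longrightarrow> x < n \<Longrightarrow> y < n \<Longrightarrow>
        non_rainbow (h (a, b, c)) (h (a, x, c)) (h (a, y, c))"
      "\<And>a b c x y. a < n \<Longrightarrow> b < n \<Longrightarrow> c < n \<Longrightarrow> x < n \<Longrightarrow> y < n \<Longrightarrow>
        non_rainbow (h (a, b, c)) (h (a, b, x)) (h (a, b, y))"
  shows "card (h ` cube n) \<le> n + 1"
proof -
  have z_planes: "card ((\<lambda>(i, j). h (i, j, k)) ` ({..<n} \<times> {..<n})) \<le> 2" if k: "k < n" for k
  proof (rule two_coloured_grid [of n "\<lambda>i j. h (i, j, k)"])
    fix a b a' assume "\<And>x y. x < n \<Longrightarrow> y < n \<Longrightarrow> h (x, y, k) \<in> {h (a, b, k), h (a', b, k)}"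
    then show ?thesis by (intro card_le_two [where x = "h (a, b, k)" and y = "h (a', b, k)"]) auto
  next
    fix a b b' assume "\<And>x y. x < n \<Longrightarrow> y < n \<Longrightarrow> h (x, y, k) \<in> {h (a, b, k), h (a, b', k)}"
    then show ?thesis by (intro card_le_two [where x = "h (a, b, k)" and y = "h (a, b', k)"]) auto
  qed (rule lines T_free_rules(1) [OF T] n; use k n in simp)+
  have y_planes: "card ((\<lambda>(i, j). h (i, k, j)) ` ({..<n} \<times> {..<n})) \<le> 2" if k: "k < n" for k
  proof (rule two_coloured_grid [of n "\<lambda>i j. h (i, k, j)"])
    fix a b a' assume "\<And>x y. x < n \<Longrightarrow> y < n \<Longrightarrow> h (x, k, y) \<in> {h (a, k, b), h (a', k, b)}"
    then show ?thesis by (intro card_le_two [where x = "h (a, k, b)" and y = "h (a', k, b)"]) auto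
  next
    fix a b b' assume "\<And>x y. x < n \<Longrightarrow> y < n \<Longrightarrow> h (x, k, y) \<in> {h (a, k, b), h (a, k, b')}"
    then show ?thesis by (intro card_le_two [where x = "h (a, k, b)" and y = "h (a, k, b')"]) auto
  qed (rule lines T_free_rules(2) [OF T] n; use k n in simp)+
  show ?thesis
  \<comment> \<open>The colours of the plane \<open>x = 0\<close> are found at a common
    \<open>z\<close> or a common \<open>y\<close>; this decides which family of parallel planes is
    counted.\<close>
  proof (rule two_coloured_grid [of n "\<lambda>j k. h (0, j, k)"])
    fix b c b' assume "b < n" "c < n" "b' < n"
      "\<And>j k. j < n \<Longrightarrow> k < n \<Longrightarrow> h (0, j, k) \<in> {h (0, b, c), h (0, b', c)}"
    then show ?thesis using card_colours_by_planes [of c n h b b'] z_planes by blast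
  next
    fix b c c' assume bc: "b < n" "c < n" "c' < n"
      "\<And>j k. j < n \<Longrightarrow> k < n \<Longrightarrow> h (0, j, k) \<in> {h (0, b, c), h (0, b, c')}"
    have "card ((h \<circ> swap23) ` cube n) \<le> n + 1"
      by (rule card_colours_by_planes [of b n "h \<circ> swap23" c c']) (use y_planes bc in simp_all)
    then show ?thesis by (simp only: colours_swap)
  qed (rule lines T_free_rules(3) [OF T] n; use n in simp)+
qed

lemma T_free_colours_le:
  assumes T: "T_free n h" and n: "0 < n"
  shows "card (h ` cube n) \<le> n + 1"
proof (rule ccontr)
  assume too_many: "\<not> ?thesis"
  then have few: "\<not> card (h ` cube n) \<le> n" by simp
  \<comment> \<open>One rule per axis. For \<open>R3\<close> the composite map sends
    \<open>(a, b, c)\<close> to \<open>(b, c, a)\<close>, so the first coordinate runs along the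
    third axis.\<close>
  note R1 = T_free_rich_line [OF T]
    and R2 = T_free_rich_line [OF T_free_swap(1) [OF T], unfolded colours_swap comp_apply swap_simps]
    and R3 = T_free_rich_line [OF T_free_swap(1) [OF T_free_swap(2) [OF T]],
        unfolded colours_swap comp_apply swap_simps]
  have "non_rainbow (h (a, b, c)) (h (x, b, c)) (h (y, b, c))"
      "non_rainbow (h (a, b, c)) (h (a, x, c)) (h (a, y, c))"
      "non_rainbow (h (a, b, c)) (h (a, b, x)) (h (a, b, y))"
    if "a < n" "b < n" "c < n" "x < n" "y < n" for a b c x y
    using that few R1 [of b c a x y] R2 [of a c b x y] R3 [of a b c x y] by blast+
  then show False using T_free_colours_le_if_lines_two_coloured [OF T n] too_many by blast
qed

section \<open>Mixed paths\<close>

lemma M_free_rules: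
  assumes "M_free n h" "a < n" "b < n" "c < n" "a' < n" "b' < n" "c' < n"
  shows "b \<noteq> b' \<Longrightarrow> c \<noteq> c' \<Longrightarrow> non_rainbow (h (a', b, c)) (h (a, b, c)) (h (a, b', c'))"
    and "a \<noteq> a' \<Longrightarrow> c \<noteq> c' \<Longrightarrow> non_rainbow (h (a, b', c)) (h (a, b, c)) (h (a', b, c'))"
    and "a \<noteq> a' \<Longrightarrow> b \<noteq> b' \<Longrightarrow> non_rainbow (h (a, b, c')) (h (a, b, c)) (h (a', b', c))"
  using assms unfolding M_free_def by simp_all

text \<open>As for tight paths, a different colour at \<open>(i, j, k)\<close> would leave only two
  colours for the line.\<close>

lemma M_free_rich_line_aux:
  assumes M: "M_free n h" and bounds: "b < n" "c < n" "x < n" "y < n" "z < n"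
    and rich: "\<not> non_rainbow (h (x, b, c)) (h (y, b, c)) (h (z, b, c))"
    and ijk: "i < n" "j < n" "k < n" "j \<noteq> b" "k \<noteq> c"
  shows "h (i, j, k) = h (i, b, c)"
proof -
  have 1: "non_rainbow (h (l, b, c)) (h (i, b, c)) (h (i, j, k))" if "l < n" for l
    by (rule M_free_rules(1) [OF M]) (use that ijk bounds in auto)
  show ?thesis
    using 1 [OF bounds(3)] 1 [OF bounds(4)] 1 [OF bounds(5)] rich unfolding non_rainbow_def by metis
qed

text \<open>Colours are copied only to lines differing in both \<open>j\<close> and
  \<open>k\<close>. A line that differs so from the given line and from the target line serves as
  intermediary; \<open>n \<ge> 3\<close> provides it.\<close>

lemma M_free_rich_line:
  assumes M: "M_free n h" and n: "n \<ge> 3" and bounds: "b < n" "c < n" "x < n" "y < n" "z < n"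
    and rich: "\<not> non_rainbow (h (x, b, c)) (h (y, b, c)) (h (z, b, c))"
  shows "card (h ` cube n) \<le> n"
proof (rule card_image_first_coordinate [where f = "\<lambda>i. h (i, b, c)"])
  fix i j k assume ijk: "i < n" "j < n" "k < n"
  obtain j' where j': "j' < n" "j' \<noteq> b" "j' \<noteq> j" using exists_fresh [OF n] .
  obtain k' where k': "k' < n" "k' \<noteq> c" "k' \<noteq> k" using exists_fresh [OF n] .
  have line: "h (l, j', k') = h (l, b, c)" if "l < n" for l
    by (rule M_free_rich_line_aux [OF M bounds rich that]) (use j' k' in auto)
  have "h (i, j, k) = h (i, j', k')"
    by (rule M_free_rich_line_aux [OF M j'(1) k'(1) bounds(3-5)])
      (use line bounds rich ijk j' k' in auto)
  then show "h (i, j, k) = h (i, b, c)" using line ijk(1) by simp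
qed

definition lines_two_coloured :: "nat \<Rightarrow> (nat \<times> nat \<times> nat \<Rightarrow> nat) \<Rightarrow> bool" where
  "lines_two_coloured n h \<longleftrightarrow> (\<forall>a<n. \<forall>b<n. \<forall>c<n. \<forall>x<n. \<forall>y<n.
     non_rainbow (h (a, b, c)) (h (x, b, c)) (h (y, b, c)) \<and>
     non_rainbow (h (a, b, c)) (h (a, x, c)) (h (a, y, c)) \<and>
     non_rainbow (h (a, b, c)) (h (a, b, x)) (h (a, b, y)))"

lemma lines_two_coloured_swap:
  assumes "lines_two_coloured n h"
  shows "lines_two_coloured n (h \<circ> swap12)" "lines_two_coloured n (h \<circ> swap23)"
  using assms unfolding lines_two_coloured_def by simp_all

text \<open>The point \<open>(x, b, c)\<close> has one of the two line colours. A line point of the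
  other colour, then \<open>(x, b, c)\<close>, then \<open>(x, y, z)\<close> would be a rainbow
  mixed path if a third colour appeared.\<close>

lemma M_free_line:
  assumes M: "M_free n h" and lines: "lines_two_coloured n h"
    and bounds: "a < n" "b < n" "c < n" "a' < n" "x < n" "y < n" "z < n"
    and ne: "h (a, b, c) \<noteq> h (a', b, c)" "y \<noteq> b" "z \<noteq> c"
  shows "h (x, y, z) \<in> {h (a, b, c), h (a', b, c)}"
proof -
  have 1: "non_rainbow (h (a, b, c)) (h (a', b, c)) (h (x, b, c))"
    using lines bounds unfolding lines_two_coloured_def by simp
  have 2: "non_rainbow (h (k, b, c)) (h (x, b, c)) (h (x, y, z))" if "k < n" for k
    by (rule M_free_rules(1) [OF M]) (use that bounds ne in auto)
  show ?thesis
    using 1 2 [OF bounds(1)] 2 [OF bounds(4)] ne(1) by (auto simp: non_rainbow_def)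
qed

lemmas M_free_line_y = M_free_line [OF M_free_swap(1) lines_two_coloured_swap(1),
    unfolded comp_apply swap_simps]

lemmas M_free_line_z = M_free_line [OF M_free_swap(1) [OF M_free_swap(2)]
    lines_two_coloured_swap(1) [OF lines_two_coloured_swap(2)], unfolded comp_apply swap_simps]

text \<open>A third colour can only occur in the two planes \<open>y = b\<close> and \<open>z = c\<close> through the
  line, and any such occurrence leaves no colour for \<open>(u, v, w)\<close>.\<close>

lemma M_free_plane:
  assumes M: "M_free n h" and lines: "lines_two_coloured n h" and n: "n \<ge> 3"
    and bounds: "a < n" "b < n" "c < n" "a' < n" "x < n" "y < n"
    and ne: "h (a, b, c) \<noteq> h (a', b, c)"
  shows "h (x, y, c) \<in> {h (a, b, c), h (a', b, c)}"
proof (rule ccontr)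
  assume third: "h (x, y, c) \<notin> {h (a, b, c), h (a', b, c)}"
  have on_line: "h (x, b, c) \<in> {h (a, b, c), h (a', b, c)}"
  proof -
    have "non_rainbow (h (a, b, c)) (h (a', b, c)) (h (x, b, c))"
      using lines bounds unfolding lines_two_coloured_def by simp
    then show ?thesis using ne by (auto simp: non_rainbow_def)
  qed
  then have yb: "y \<noteq> b" using third by auto
  \<comment> \<open>The point \<open>(u, b, c)\<close> has the line colour that
    \<open>(x, b, c)\<close> lacks.\<close>
  obtain u where u: "u < n" "h (u, b, c) \<in> {h (a, b, c), h (a', b, c)}" "h (u, b, c) \<noteq> h (x, b, c)"
    using on_line ne bounds by (cases "h (x, b, c) = h (a, b, c)") auto
  then have ux: "u \<noteq> x" by auto
  obtain v where v: "v < n" "v \<noteq> b" "v \<noteq> y" using exists_fresh [OF n] .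
  obtain w where w: "w < n" "w \<noteq> c" using exists_fresh [OF n] by blast
  have off: "h (i, j, w) \<in> {h (a, b, c), h (a', b, c)}" if "i < n" "j < n" "j \<noteq> b" for i j
    by (rule M_free_line [OF M lines]) (use bounds ne w that in auto)
  have off_line: "h (x, b, c) \<noteq> h (x, y, c)" using on_line third by metis
  have 1: "h (u, v, w) \<in> {h (x, b, c), h (x, y, c)}"
    by (rule M_free_line_y [OF M lines]) (use bounds u(1) ux v w off_line in simp_all)
  have z: "h (x, y, c) \<noteq> h (x, y, w)" using off [OF bounds(5,6) yb] third by metis
  have 2: "h (u, j, k) \<in> {h (x, y, c), h (x, y, w)}" if "j < n" "k < n" "j \<noteq> y" for j k
    by (rule M_free_line_z [OF M lines]) (use bounds u(1) ux w z that in simp_all)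
  have 3: "h (u, b, c) = h (x, y, w)"
    using 2 [OF bounds(2,3) yb [symmetric]] u(2) third by (metis insertE singletonD)
  have 4: "h (u, v, w) \<noteq> h (x, y, c)" using off [OF u(1) v(1,2)] third by metis
  then have "h (u, v, w) = h (x, b, c)" "h (u, v, w) = h (x, y, w)"
    using 1 2 [OF v(1) w(1) v(3)] by simp_all
  then show False using 3 u(3) by simp
qed

text \<open>\<open>M_free_line\<close> covers the points off the planes \<open>y = b\<close> and
  \<open>z = c\<close>; \<open>M_free_plane\<close> covers \<open>z = c\<close> and, after a swap,
  \<open>y = b\<close>.\<close>

lemma M_free_colours_le_two:
  assumes M: "M_free n h" and lines: "lines_two_coloured n h" and n: "n \<ge> 3"
    and bounds: "a < n" "b < n" "c < n" "a' < n"
    and ne: "h (a, b, c) \<noteq> h (a', b, c)"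
  shows "card (h ` cube n) \<le> 2"
proof (rule card_le_two, rule image_subsetI)
  fix p assume p: "p \<in> cube n"
  obtain x y z where xyz: "p = (x, y, z)" by (cases p)
  note plane_y = M_free_plane [OF M_free_swap(2) lines_two_coloured_swap(2), OF M lines n,
      unfolded comp_apply swap_simps]
  consider "z = c" | "y = b" | "y \<noteq> b" "z \<noteq> c" by blast
  then show "h p \<in> {h (a, b, c), h (a', b, c)}"
  proof cases
    case 1
    then show ?thesis using M_free_plane [OF M lines n bounds _ _ ne] p by (simp add: xyz)
  next
    case 2
    then show ?thesis using plane_y [OF bounds(1,3,2,4) _ _ ne] p by (simp add: xyz)
  next
    case 3
    then show ?thesis using M_free_line [OF M lines bounds _ _ _ ne] p by (simp add: xyz)
  qed
qed

lemma M_free_colours_le: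
  assumes M: "M_free n h" and n: "n \<ge> 3"
  shows "card (h ` cube n) \<le> n"
proof (rule ccontr)
  assume too_many: "\<not> ?thesis"
  \<comment> \<open>\<open>swap13\<close> belongs to the cyclic map from \<open>(a, b, c)\<close> to
    \<open>(b, c, a)\<close>.\<close>
  note swap12 = M_free_swap(1) [OF M] and swap13 = M_free_swap(1) [OF M_free_swap(2) [OF M]]
  note R1 = M_free_rich_line [OF M n]
    and R2 = M_free_rich_line [OF swap12 n, unfolded colours_swap comp_apply swap_simps]
    and R3 = M_free_rich_line [OF swap13 n, unfolded colours_swap comp_apply swap_simps]
  have "non_rainbow (h (a, b, c)) (h (x, b, c)) (h (y, b, c))"
      "non_rainbow (h (a, b, c)) (h (a, x, c)) (h (a, y, c))"
      "non_rainbow (h (a, b, c)) (h (a, b, x)) (h (a, b, y))"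
    if "a < n" "b < n" "c < n" "x < n" "y < n" for a b c x y
    using that too_many R1 [of b c a x y] R2 [of a c b x y] R3 [of a b c x y] by blast+
  then have lines: "lines_two_coloured n h"
    unfolding lines_two_coloured_def by simp
  note l12 = lines_two_coloured_swap(1) [OF lines]
    and l13 = lines_two_coloured_swap(1) [OF lines_two_coloured_swap(2) [OF lines]]
  have "\<not> card (h ` cube n) \<le> 2" using too_many n by simp
  \<comment> \<open>A line with two colours would leave two colours in all, so every line is
    monochromatic.\<close>
  then have eq: "h (a, b, c) = h (a', b, c)" "h (b, a, c) = h (b, a', c)" "h (b, c, a) = h (b, c, a')"
    if "a < n" "b < n" "c < n" "a' < n" for a b c a'
    using M_free_colours_le_two [OF M lines n that]
      M_free_colours_le_two [OF swap12 l12 n that, unfolded colours_swap comp_apply swap_simps]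
      M_free_colours_le_two [OF swap13 l13 n that, unfolded colours_swap comp_apply swap_simps]
    by metis+
  have "h (i, j, k) = h (i, 0, 0)" if "i < n" "j < n" "k < n" for i j k
    using eq(2) [of j i k 0] eq(3) [of k i 0 0] that n by simp
  then have "card (h ` cube n) \<le> n" by (rule card_image_first_coordinate)
  then show False using too_many by blast
qed

section \<open>Rainbow copies in the complete 3-partite 3-graph\<close>

text \<open>Vertex labels and part numbers contain the numeral \<open>1\<close>, which must not be
  rewritten to \<open>Suc 0\<close>.\<close>

declare One_nat_def [simp del]

definition triple_colour :: "((nat \<times> nat) set \<Rightarrow> nat) \<Rightarrow> nat \<times> nat \<times> nat \<Rightarrow> nat" where
  "triple_colour col = (\<lambda>(a, b, c). col {(0, a), (1, b), (2, c)})"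

lemma triple_colour_simp: "triple_colour col (a, b, c) = col {(0, a), (1, b), (2, c)}"
  by (simp add: triple_colour_def)

lemma edges_complete_3partite:
  "edges (complete_3partite n) = (\<lambda>(a, b, c). {(0, a), (1, b), (2, c)}) ` cube n"
  by (force simp: complete_3partite_def cube_def)

lemma colours_complete_3partite:
  "col ` edges (complete_3partite n) = triple_colour col ` cube n"
  by (simp add: edges_complete_3partite image_image triple_colour_def case_prod_unfold)

text \<open>All assignments of the three parts to roles in a path, so that each embedding is built
  only once.\<close>

definition part_orders :: "(nat \<times> nat \<times> nat) set" where
  "part_orders = {(0, 1, 2), (0, 2, 1), (1, 0, 2), (1, 2, 0), (2, 0, 1), (2, 1, 0)}"

lemma part_orders_edge:
  assumes "(i, j, k) \<in> part_orders" "a < n" "b < n" "c < n"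
  shows "{(i, a), (j, b), (k, c)} \<in> edges (complete_3partite n)"
proof -
  have edge: "{(0, x), (1, y), (2, z)} \<in> edges (complete_3partite n)"
    if "x < n" "y < n" "z < n" for x y z
    using that by (auto simp: complete_3partite_def)
  consider "i = 0" "j = 1" "k = 2" | "i = 0" "j = 2" "k = 1" | "i = 1" "j = 0" "k = 2"
    | "i = 1" "j = 2" "k = 0" | "i = 2" "j = 0" "k = 1" | "i = 2" "j = 1" "k = 0"
    using assms(1) unfolding part_orders_def by auto
  then show ?thesis
    using edge [of a b c] edge [of a c b] edge [of b a c] edge [of c a b] edge [of b c a]
      edge [of c b a] assms(2-4)
    by cases (simp_all add: insert_commute)
qed

lemma part_orders_distinct:
  assumes "(i, j, k) \<in> part_orders"
  shows "i \<noteq> j" "j \<noteq> k" "i \<noteq> k" "i < 3" "j < 3" "k < 3"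
  using assms unfolding part_orders_def by auto

lemma verts_complete_3partite: "(i, a) \<in> verts (complete_3partite n) \<longleftrightarrow> i < 3 \<and> a < n"
  by (simp add: complete_3partite_def)

lemma atLeastAtMost_1_numeral:
  "{1..5::nat} = {1, 2, 3, 4, 5}" "{1..6::nat} = {1, 2, 3, 4, 5, 6}"
  "{1..7::nat} = {1, 2, 3, 4, 5, 6, 7}"
  by auto

lemma has_rainbow_T:
  assumes ijk: "(i, j, k) \<in> part_orders" and bounds: "a < n" "b < n" "c < n" "a' < n" "b' < n"
    and rainbow: "\<not> non_rainbow (col {(i, a'), (j, b), (k, c)}) (col {(i, a), (j, b), (k, c)})
      (col {(i, a), (j, b'), (k, c)})"
  shows "has_rainbow_copy (complete_3partite n) col path_T"
proof -
  \<comment> \<open>Vertices 1 and 4 share a part, as do 2 and 5; only the values on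
    \<open>{1..5}\<close> matter.\<close>
  define f where "f = (\<lambda>_ :: nat. undefined)(1 := (i, a'), 2 := (j, b), 3 := (k, c), 4 := (i, a), 5 := (j, b'))"
  have f: "f 1 = (i, a')" "f 2 = (j, b)" "f 3 = (k, c)" "f 4 = (i, a)" "f 5 = (j, b')"
    by (simp_all add: f_def)
  have ne: "a \<noteq> a'" "b \<noteq> b'" using rainbow by (auto simp: non_rainbow_def)
  note ijk' = part_orders_distinct [OF ijk]
  have images: "f ` {1, 2, 3} = {(i, a'), (j, b), (k, c)}" "f ` {2, 3, 4} = {(i, a), (j, b), (k, c)}"
    "f ` {3, 4, 5} = {(i, a), (j, b'), (k, c)}"
    unfolding image_insert image_empty f by blast+
  have "inj_on f (verts path_T)"
    using ne ijk' by (simp add: path_T_def atLeastAtMost_1_numeral f)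
  moreover have "f ` verts path_T \<subseteq> verts (complete_3partite n)"
    using bounds ijk' by (simp add: path_T_def atLeastAtMost_1_numeral f verts_complete_3partite)
  moreover have "\<forall>e\<in>edges path_T. f ` e \<in> edges (complete_3partite n)"
    unfolding path_T_def snd_conv ball_simps images
    using part_orders_edge [OF ijk] bounds by blast
  moreover have "inj_on col ((\<lambda>e. f ` e) ` edges path_T)"
    unfolding path_T_def snd_conv image_insert [where f = "\<lambda>e. f ` e"] image_empty images
    using rainbow by (auto simp: non_rainbow_def inj_on_def)
  ultimately show ?thesis unfolding has_rainbow_copy_def is_embedding_def by blast
qed

lemma has_rainbow_M:
  assumes ijk: "(i, j, k) \<in> part_orders"
    and bounds: "a < n" "b < n" "c < n" "a' < n" "b' < n" "c' < n" and ne: "b \<noteq> b'" "c \<noteq> c'"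
    and rainbow: "\<not> non_rainbow (col {(i, a'), (j, b), (k, c)}) (col {(i, a), (j, b), (k, c)})
      (col {(i, a), (j, b'), (k, c')})"
  shows "has_rainbow_copy (complete_3partite n) col path_M"
proof -
  define f where "f = (\<lambda>_ :: nat. undefined)(1 := (i, a'), 2 := (j, b), 3 := (k, c), 4 := (i, a),
    5 := (j, b'), 6 := (k, c'))"
  have f: "f 1 = (i, a')" "f 2 = (j, b)" "f 3 = (k, c)" "f 4 = (i, a)" "f 5 = (j, b')" "f 6 = (k, c')"
    by (simp_all add: f_def)
  have ne': "a \<noteq> a'" using rainbow by (auto simp: non_rainbow_def)
  note ijk' = part_orders_distinct [OF ijk]
  have images: "f ` {1, 2, 3} = {(i, a'), (j, b), (k, c)}" "f ` {2, 3, 4} = {(i, a), (j, b), (k, c)}"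
    "f ` {4, 5, 6} = {(i, a), (j, b'), (k, c')}"
    unfolding image_insert image_empty f by blast+
  have "inj_on f (verts path_M)"
    using ne ne' ijk' by (simp add: path_M_def atLeastAtMost_1_numeral f)
  moreover have "f ` verts path_M \<subseteq> verts (complete_3partite n)"
    using bounds ijk' by (simp add: path_M_def atLeastAtMost_1_numeral f verts_complete_3partite)
  moreover have "\<forall>e\<in>edges path_M. f ` e \<in> edges (complete_3partite n)"
    unfolding path_M_def snd_conv ball_simps images
    using part_orders_edge [OF ijk] bounds by blast
  moreover have "inj_on col ((\<lambda>e. f ` e) ` edges path_M)"
    unfolding path_M_def snd_conv image_insert [where f = "\<lambda>e. f ` e"] image_empty images
    using rainbow by (auto simp: non_rainbow_def inj_on_def)
  ultimately show ?thesis unfolding has_rainbow_copy_def is_embedding_def by blast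
qed

lemma has_rainbow_L:
  assumes ijk: "(i, j, k) \<in> part_orders"
    and bounds: "a < n" "b < n" "c < n" "a' < n" "b' < n" "c' < n" "m < n"
    and ne: "a \<noteq> a'" "b \<noteq> b'" "c \<noteq> c'" "m \<noteq> c" "m \<noteq> c'"
    and rainbow: "\<not> non_rainbow (col {(i, a), (j, b), (k, c)}) (col {(i, a), (j, b'), (k, m)})
      (col {(i, a'), (j, b'), (k, c')})"
  shows "has_rainbow_copy (complete_3partite n) col path_L"
proof -
  \<comment> \<open>The joints are 3 and 5. Vertices 1, 4 and 7 lie in the part \<open>k\<close>, so
    \<open>m\<close> must avoid both \<open>c\<close> and \<open>c'\<close>.\<close>
  define f where "f = (\<lambda>_ :: nat. undefined)(1 := (k, c), 2 := (j, b), 3 := (i, a), 4 := (k, m),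
    5 := (j, b'), 6 := (i, a'), 7 := (k, c'))"
  have f: "f 1 = (k, c)" "f 2 = (j, b)" "f 3 = (i, a)" "f 4 = (k, m)" "f 5 = (j, b')" "f 6 = (i, a')"
    "f 7 = (k, c')"
    by (simp_all add: f_def)
  note ijk' = part_orders_distinct [OF ijk]
  have images: "f ` {1, 2, 3} = {(i, a), (j, b), (k, c)}" "f ` {3, 4, 5} = {(i, a), (j, b'), (k, m)}"
    "f ` {5, 6, 7} = {(i, a'), (j, b'), (k, c')}"
    unfolding image_insert image_empty f by blast+
  have "inj_on f (verts path_L)"
    using ne ijk' by (simp add: path_L_def atLeastAtMost_1_numeral f)
  moreover have "f ` verts path_L \<subseteq> verts (complete_3partite n)"
    using bounds ijk' by (simp add: path_L_def atLeastAtMost_1_numeral f verts_complete_3partite)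
  moreover have "\<forall>e\<in>edges path_L. f ` e \<in> edges (complete_3partite n)"
    unfolding path_L_def snd_conv ball_simps images
    using part_orders_edge [OF ijk] bounds by blast
  moreover have "inj_on col ((\<lambda>e. f ` e) ` edges path_L)"
    unfolding path_L_def snd_conv image_insert [where f = "\<lambda>e. f ` e"] image_empty images
    using rainbow by (auto simp: non_rainbow_def inj_on_def)
  ultimately show ?thesis unfolding has_rainbow_copy_def is_embedding_def by blast
qed

lemma T_free_triple_colour:
  assumes "\<not> has_rainbow_copy (complete_3partite n) col path_T"
  shows "T_free n (triple_colour col)"
proof -
  note T = has_rainbow_T [where n = n and col = col]
  show ?thesis
    unfolding T_free_def triple_colour_simp
  proof (intro allI impI conjI)
    fix a b c a' b' c' assume bounds: "a < n" "b < n" "c < n" "a' < n" "b' < n" "c' < n"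
    show "non_rainbow (col {(0, a'), (1, b), (2, c)}) (col {(0, a), (1, b), (2, c)})
        (col {(0, a), (1, b'), (2, c)})"
      using T [of 0 1 2 a b c a' b'] assms bounds by (auto simp: part_orders_def)
    show "non_rainbow (col {(0, a'), (1, b), (2, c)}) (col {(0, a), (1, b), (2, c)})
        (col {(0, a), (1, b), (2, c')})"
      using T [of 0 2 1 a c b a' c'] assms bounds by (auto simp: part_orders_def insert_commute)
    show "non_rainbow (col {(0, a), (1, b'), (2, c)}) (col {(0, a), (1, b), (2, c)})
        (col {(0, a), (1, b), (2, c')})"
      using T [of 1 2 0 b c a b' c'] assms bounds by (auto simp: part_orders_def insert_commute)
  qed
qed

lemma M_free_triple_colour:
  assumes "\<not> has_rainbow_copy (complete_3partite n) col path_M"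
  shows "M_free n (triple_colour col)"
proof -
  note M = has_rainbow_M [where n = n and col = col]
  show ?thesis
    unfolding M_free_def triple_colour_simp
  proof (intro allI impI conjI)
    fix a b c a' b' c' assume bounds: "a < n" "b < n" "c < n" "a' < n" "b' < n" "c' < n"
    show "non_rainbow (col {(0, a'), (1, b), (2, c)}) (col {(0, a), (1, b), (2, c)})
        (col {(0, a), (1, b'), (2, c')})" if "b \<noteq> b' \<and> c \<noteq> c'"
      using M [of 0 1 2 a b c a' b' c'] that assms bounds by (auto simp: part_orders_def)
    show "non_rainbow (col {(0, a), (1, b'), (2, c)}) (col {(0, a), (1, b), (2, c)})
        (col {(0, a'), (1, b), (2, c')})" if "a \<noteq> a' \<and> c \<noteq> c'"
      using M [of 1 0 2 b a c b' a' c'] that assms bounds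
      by (auto simp: part_orders_def insert_commute)
    show "non_rainbow (col {(0, a), (1, b), (2, c')}) (col {(0, a), (1, b), (2, c)})
        (col {(0, a'), (1, b'), (2, c)})" if "a \<noteq> a' \<and> b \<noteq> b'"
      using M [of 2 0 1 c a b c' a' b'] that assms bounds
      by (auto simp: part_orders_def insert_commute)
  qed
qed

lemma L_free_triple_colour:
  assumes "\<not> has_rainbow_copy (complete_3partite n) col path_L"
  shows "L_free n (triple_colour col)"
proof -
  note L = has_rainbow_L [where n = n and col = col]
  show ?thesis
    unfolding L_free_def triple_colour_simp
  proof (intro allI impI conjI)
    fix a b c a' b' c' m assume bounds: "a < n" "b < n" "c < n" "a' < n" "b' < n" "c' < n" "m < n"
      and ne: "a \<noteq> a' \<and> b \<noteq> b' \<and> c \<noteq> c'"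
    show "non_rainbow (col {(0, a), (1, b), (2, c)}) (col {(0, a), (1, b'), (2, m)})
        (col {(0, a'), (1, b'), (2, c')})" if "m \<noteq> c \<and> m \<noteq> c'"
      using L [of 0 1 2 a b c a' b' c' m] that assms bounds ne by (auto simp: part_orders_def)
    show "non_rainbow (col {(0, a), (1, b), (2, c)}) (col {(0, a), (1, m), (2, c')})
        (col {(0, a'), (1, b'), (2, c')})" if "m \<noteq> b \<and> m \<noteq> b'"
      using L [of 0 2 1 a c b a' c' b' m] that assms bounds ne
      by (auto simp: part_orders_def insert_commute)
    show "non_rainbow (col {(0, a), (1, b), (2, c)}) (col {(0, m), (1, b), (2, c')})
        (col {(0, a'), (1, b'), (2, c')})" if "m \<noteq> a \<and> m \<noteq> a'"
      using L [of 1 2 0 b c a b' c' a' m] that assms bounds ne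
      by (auto simp: part_orders_def insert_commute)
  qed
qed

section \<open>Extremal colourings\<close>

text \<open>The threshold is one above the largest number of colours without a rainbow copy; the
  witness \<open>col\<close> excludes every \<open>k \<le> m\<close>.\<close>

lemma anti_ramsey_eqI:
  fixes H :: "'a hypergraph" and col :: "'a set \<Rightarrow> nat"
  assumes "card (col ` edges H) = m" "\<not> has_rainbow_copy H col G"
    and "\<And>col :: 'a set \<Rightarrow> nat. \<not> has_rainbow_copy H col G \<Longrightarrow> card (col ` edges H) \<le> m"
  shows "anti_ramsey H G = m + 1"
  unfolding anti_ramsey_def
proof (rule Least_equality)
  show "\<forall>col :: 'a set \<Rightarrow> nat. m + 1 \<le> card (col ` edges H) \<longrightarrow> has_rainbow_copy H col G"
    using assms(3) by fastforce
next
  fix k assume k: "\<forall>col :: 'a set \<Rightarrow> nat. k \<le> card (col ` edges H) \<longrightarrow> has_rainbow_copy H col G"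
  show "m + 1 \<le> k"
  proof (rule ccontr)
    assume "\<not> m + 1 \<le> k"
    then show False using k assms(1,2) by auto
  qed
qed

lemma edge_cases:
  assumes "e \<in> edges (complete_3partite n)"
  obtains a b c where "e = {(0, a), (1, b), (2, c)}" "a < n" "b < n" "c < n"
  using assms by (auto simp: complete_3partite_def)

lemma card_colours_eqI:
  assumes "triple_colour col ` cube n = {..<m}"
  shows "card (col ` edges (complete_3partite n)) = m"
  by (simp add: colours_complete_3partite assms)

text \<open>Meant for host edges, which have exactly one vertex in each part.\<close>

definition vertex_in_part :: "nat \<Rightarrow> (nat \<times> nat) set \<Rightarrow> nat" where
  "vertex_in_part i e = (THE a. (i, a) \<in> e)"

lemma vertex_in_part_triple [simp]:
  "vertex_in_part 0 {(0, a), (1, b), (2, c)} = a"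
  "vertex_in_part 2 {(0, a), (1, b), (2, c)} = c"
  by (auto simp: vertex_in_part_def)

lemma vertex_in_part_0_iff:
  "e \<in> edges (complete_3partite n) \<Longrightarrow> (0, a) \<in> e \<longleftrightarrow> a = vertex_in_part 0 e"
  by (elim edge_cases) auto

text \<open>Injectivity of \<open>f\<close> on vertices keeps the images of distinct edges distinct,
  so their colours differ too.\<close>

lemma rainbow_copyE:
  assumes "has_rainbow_copy H col G" "\<And>e. e \<in> edges G \<Longrightarrow> e \<subseteq> verts G"
  obtains f where "inj_on f (verts G)" "\<And>e. e \<in> edges G \<Longrightarrow> f ` e \<in> edges H"
    "\<And>e e'. e \<in> edges G \<Longrightarrow> e' \<in> edges G \<Longrightarrow> e \<noteq> e' \<Longrightarrow> col (f ` e) \<noteq> col (f ` e')"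
proof -
  obtain f where f: "inj_on f (verts G)" "\<forall>e\<in>edges G. f ` e \<in> edges H"
    "inj_on col ((\<lambda>e. f ` e) ` edges G)"
    using assms(1) unfolding has_rainbow_copy_def is_embedding_def by blast
  have "col (f ` e) \<noteq> col (f ` e')" if e: "e \<in> edges G" "e' \<in> edges G" "e \<noteq> e'" for e e'
  proof -
    have "f ` e \<noteq> f ` e'" using inj_on_image_eq_iff [OF f(1)] assms(2) e by blast
    then show ?thesis using inj_on_eq_iff [OF f(3)] e by blast
  qed
  then show ?thesis using that f by blast
qed

lemma anti_ramsey_M:
  assumes "n \<ge> 3"
  shows "anti_ramsey (complete_3partite n) path_M = n + 1"
proof (rule anti_ramsey_eqI [where col = "vertex_in_part 0"])
  have "triple_colour (vertex_in_part 0) ` cube n = {..<n}"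
  proof (intro equalityI subsetI)
    fix x assume "x \<in> {..<n}"
    then have "(x, 0, 0) \<in> cube n" "triple_colour (vertex_in_part 0) (x, 0, 0) = x"
      by (auto simp: triple_colour_simp)
    then show "x \<in> triple_colour (vertex_in_part 0) ` cube n" by (metis imageI)
  qed (auto simp: cube_def triple_colour_simp)
  then show "card (vertex_in_part 0 ` edges (complete_3partite n)) = n" by (rule card_colours_eqI)
next
  \<comment> \<open>The outer edges cover the middle one. Its vertex in part 0 therefore lies in an
    outer edge, which then has the same colour.\<close>
  show "\<not> has_rainbow_copy (complete_3partite n) (vertex_in_part 0) path_M"
  proof
    assume "has_rainbow_copy (complete_3partite n) (vertex_in_part 0) path_M"
    then obtain f where f: "\<And>e. e \<in> edges path_M \<Longrightarrow> f ` e \<in> edges (complete_3partite n)"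
      "\<And>e e'. e \<in> edges path_M \<Longrightarrow> e' \<in> edges path_M \<Longrightarrow> e \<noteq> e' \<Longrightarrow>
        vertex_in_part 0 (f ` e) \<noteq> vertex_in_part 0 (f ` e')"
      by (rule rainbow_copyE) (auto simp: path_M_def)
    let ?e1 = "f ` {1, 2, 3}" and ?e2 = "f ` {2, 3, 4}" and ?e3 = "f ` {4, 5, 6}"
    have E: "?e1 \<in> edges (complete_3partite n)" "?e2 \<in> edges (complete_3partite n)"
      "?e3 \<in> edges (complete_3partite n)"
      by (rule f(1), simp add: path_M_def)+
    have "vertex_in_part 0 ?e1 \<noteq> vertex_in_part 0 ?e2" "vertex_in_part 0 ?e2 \<noteq> vertex_in_part 0 ?e3"
      by (rule f(2); simp add: path_M_def set_eq_subset)+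
    then have "(0, vertex_in_part 0 ?e2) \<notin> ?e1" "(0, vertex_in_part 0 ?e2) \<notin> ?e3"
      using vertex_in_part_0_iff [OF E(1)] vertex_in_part_0_iff [OF E(3)] by metis+
    moreover have "(0, vertex_in_part 0 ?e2) \<in> ?e2" using vertex_in_part_0_iff [OF E(2)] by metis
    moreover have "?e2 \<subseteq> ?e1 \<union> ?e3" by blast
    ultimately show False by blast
  qed
next
  fix col :: "(nat \<times> nat) set \<Rightarrow> nat" assume "\<not> has_rainbow_copy (complete_3partite n) col path_M"
  then show "card (col ` edges (complete_3partite n)) \<le> n"
    using M_free_colours_le [OF M_free_triple_colour assms] by (simp add: colours_complete_3partite)
qed

text \<open>The diagonal edges form a perfect matching; \<open>Suc\<close> reserves 0 for all other
  edges.\<close>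

definition diagonal_colour :: "(nat \<times> nat) set \<Rightarrow> nat" where
  "diagonal_colour e =
     (if \<exists>i. e = {(0, i), (1, i), (2, i)} then Suc (vertex_in_part 0 e) else 0)"

lemma triple_eq_iff:
  "{(0::nat, a), (1, b), (2, c)} = {(0, a'), (1, b'), (2, c')} \<longleftrightarrow> a = a' \<and> b = b' \<and> c = c'"
  by (auto simp: set_eq_subset)

lemma diagonal_colour_triple:
  "diagonal_colour {(0, a), (1, b), (2, c)} = (if a = b \<and> b = c then Suc a else 0)"
  unfolding diagonal_colour_def triple_eq_iff by simp

lemma diagonal_colour_eqI:
  assumes "diagonal_colour e \<noteq> 0" "diagonal_colour e' \<noteq> 0" "v \<in> e" "v \<in> e'"
  shows "diagonal_colour e = diagonal_colour e'"
proof -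
  obtain i j where "e = {(0, i), (1, i), (2, i)}" "e' = {(0, j), (1, j), (2, j)}"
    using assms(1,2) unfolding diagonal_colour_def by metis
  then show ?thesis using assms(3,4) by auto
qed

lemma anti_ramsey_T:
  assumes "n \<ge> 3"
  shows "anti_ramsey (complete_3partite n) path_T = n + 2"
proof -
  have "anti_ramsey (complete_3partite n) path_T = (n + 1) + 1"
  proof (rule anti_ramsey_eqI [where col = diagonal_colour])
    have "triple_colour diagonal_colour ` cube n = {..<n + 1}"
    proof (intro equalityI subsetI)
      fix x assume "x \<in> triple_colour diagonal_colour ` cube n"
      then show "x \<in> {..<n + 1}"
        by (auto simp: triple_colour_simp cube_def diagonal_colour_triple split: if_splits)
    next
      fix x assume x: "x \<in> {..<n + 1}"
      define p where "p = (if x = 0 then (0, 1, 0) else (x - 1, x - 1, x - 1))"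
      have "p \<in> cube n" "triple_colour diagonal_colour p = x"
        using x assms by (auto simp: p_def triple_colour_simp diagonal_colour_triple)
      then show "x \<in> triple_colour diagonal_colour ` cube n" by blast
    qed
    then show "card (diagonal_colour ` edges (complete_3partite n)) = n + 1" by (rule card_colours_eqI)
  next
    show "\<not> has_rainbow_copy (complete_3partite n) diagonal_colour path_T"
    proof
      assume "has_rainbow_copy (complete_3partite n) diagonal_colour path_T"
      then obtain f where f: "\<And>e e'. e \<in> edges path_T \<Longrightarrow> e' \<in> edges path_T \<Longrightarrow> e \<noteq> e' \<Longrightarrow>
          diagonal_colour (f ` e) \<noteq> diagonal_colour (f ` e')"
        by (rule rainbow_copyE) (auto simp: path_T_def)
      let ?e1 = "f ` {1, 2, 3}" and ?e2 = "f ` {2, 3, 4}" and ?e3 = "f ` {3, 4, 5}"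
      have "diagonal_colour ?e1 \<noteq> diagonal_colour ?e2" "diagonal_colour ?e2 \<noteq> diagonal_colour ?e3"
        "diagonal_colour ?e1 \<noteq> diagonal_colour ?e3"
        by (rule f; simp add: path_T_def set_eq_subset)+
      \<comment> \<open>All three edges contain vertex 3, and two of three distinct colours are
        nonzero; but nonzero edges sharing a vertex have equal colours.\<close>
      moreover have "f 3 \<in> ?e1" "f 3 \<in> ?e2" "f 3 \<in> ?e3" by blast+
      ultimately show False using diagonal_colour_eqI by metis
    qed
  next
    fix col :: "(nat \<times> nat) set \<Rightarrow> nat" assume "\<not> has_rainbow_copy (complete_3partite n) col path_T"
    then show "card (col ` edges (complete_3partite n)) \<le> n + 1"
      unfolding colours_complete_3partite
      using T_free_colours_le [OF T_free_triple_colour] assms by simp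
  qed
  then show ?thesis by simp
qed

text \<open>The edges through \<open>(0, 0)\<close> and \<open>(1, 0)\<close> form an axis-parallel
  line of the cube; 0 is again the colour of the rest.\<close>

definition line_colour :: "(nat \<times> nat) set \<Rightarrow> nat" where
  "line_colour e = (if (0, 0) \<in> e \<and> (1, 0) \<in> e then Suc (vertex_in_part 2 e) else 0)"

lemma line_colour_triple:
  "line_colour {(0, a), (1, b), (2, c)} = (if a = 0 \<and> b = 0 then Suc c else 0)"
  by (simp add: line_colour_def)

lemma anti_ramsey_L:
  assumes "n \<ge> 3"
  shows "anti_ramsey (complete_3partite n) path_L = n + 2"
proof -
  have "anti_ramsey (complete_3partite n) path_L = (n + 1) + 1"
  proof (rule anti_ramsey_eqI [where col = line_colour])
    have "triple_colour line_colour ` cube n = {..<n + 1}"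
    proof (intro equalityI subsetI)
      fix x assume "x \<in> triple_colour line_colour ` cube n"
      then show "x \<in> {..<n + 1}"
        by (auto simp: triple_colour_simp cube_def line_colour_triple split: if_splits)
    next
      fix x assume x: "x \<in> {..<n + 1}"
      define p where "p = (if x = 0 then (1, 0, 0) else (0 :: nat, 0 :: nat, x - 1))"
      have "p \<in> cube n" "triple_colour line_colour p = x"
        using x assms by (auto simp: p_def triple_colour_simp line_colour_triple)
      then show "x \<in> triple_colour line_colour ` cube n" by blast
    qed
    then show "card (line_colour ` edges (complete_3partite n)) = n + 1" by (rule card_colours_eqI)
  next
    show "\<not> has_rainbow_copy (complete_3partite n) line_colour path_L"
    proof
      assume "has_rainbow_copy (complete_3partite n) line_colour path_L"
      then obtain f where f: "inj_on f (verts path_L)"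
        "\<And>e e'. e \<in> edges path_L \<Longrightarrow> e' \<in> edges path_L \<Longrightarrow> e \<noteq> e' \<Longrightarrow>
          line_colour (f ` e) \<noteq> line_colour (f ` e')"
        by (rule rainbow_copyE) (auto simp: path_L_def)
      let ?e1 = "f ` {1, 2, 3}" and ?e2 = "f ` {3, 4, 5}" and ?e3 = "f ` {5, 6, 7}"
      have "line_colour ?e1 \<noteq> line_colour ?e2" "line_colour ?e2 \<noteq> line_colour ?e3"
        "line_colour ?e1 \<noteq> line_colour ?e3"
        by (rule f(2); simp add: path_L_def set_eq_subset)+
      \<comment> \<open>Two edges of nonzero colour share two vertices, whereas two edges of a loose
        path share at most one.\<close>
      moreover have small: "line_colour (f ` A) = 0 \<or> line_colour (f ` B) = 0"
        if AB: "A \<subseteq> {1..7}" "B \<subseteq> {1..7}" "A \<inter> B \<subseteq> {v}" for A B v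
      proof (rule ccontr)
        assume "\<not> ?thesis"
        then have "{(0, 0), (1, 0)} \<subseteq> f ` A \<inter> f ` B"
          unfolding line_colour_def by (metis IntI empty_subsetI insert_subset)
        also have "\<dots> = f ` (A \<inter> B)"
          using inj_on_image_Int [OF f(1)] AB by (simp add: path_L_def)
        also have "\<dots> \<subseteq> {f v}" using AB(3) by blast
        finally have "(0, 0) = f v" "(1, 0) = f v" by auto
        then show False by (metis Pair_inject zero_neq_one)
      qed
      moreover have "line_colour ?e1 = 0 \<or> line_colour ?e2 = 0" by (rule small [of _ _ 3]) auto
      moreover have "line_colour ?e2 = 0 \<or> line_colour ?e3 = 0" by (rule small [of _ _ 5]) auto
      \<comment> \<open>The outer edges are disjoint, so the value 0 for \<open>v\<close> is
        arbitrary.\<close>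
      moreover have "line_colour ?e1 = 0 \<or> line_colour ?e3 = 0" by (rule small [of _ _ 0]) auto
      ultimately show False by metis
    qed
  next
    fix col :: "(nat \<times> nat) set \<Rightarrow> nat" assume "\<not> has_rainbow_copy (complete_3partite n) col path_L"
    then show "card (col ` edges (complete_3partite n)) \<le> n + 1"
      using L_free_colours_le [OF L_free_triple_colour assms] by (simp add: colours_complete_3partite)
  qed
  then show ?thesis by simp
qed

theorem theorem1p19:
  fixes n :: nat
  assumes "n \<ge> 3"
  shows "anti_ramsey (complete_3partite n) path_M = n + 1
    \<and> anti_ramsey (complete_3partite n) path_T = n + 2
    \<and> anti_ramsey (complete_3partite n) path_L = n + 2"
  using anti_ramsey_M [OF assms] anti_ramsey_T [OF assms] anti_ramsey_L [OF assms] by simp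

end
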